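(* Let $\Omega\subset\mathbb{R}^d$ be compact with boundary of Lebesgue measure zero, let $u_0:\Omega\to\mathbb{R}$ be lower semi-continuous, and let $\lambda>0$. Let $\mu\in\mathcal{P}(\Omega)$ satisfy $\mu\ll\mathcal{L}_d$. Let $T:\Omega\to\Omega$ be a Borel map which coincides with $I-\nabla(-\lambda u_0)^{c_2}$, $\mu$-almost everywhere. Then the measure $T_\#\mu$ is the unique solution to the optimization problem $$\inf_{\rho\in\mathcal{P}(\Omega)}\ \frac12W_2^2(\rho,\mu)+\lambda\langle u_0,\rho\rangle .$$
   Context: $\mathcal{P}(\Omega)$ is the set of Borel probability measures on $\Omega$, $\mathcal{L}_d$ is Lebesgue measure, $I$ is the identity map, $W_2$ is the Wasserstein 2 distance for the Euclidean distance, and $\langle u_0,\rho\rangle=\int_\Omega u_0\,d\rho$. With $c_2(x,y)=\frac12|x-y|^2$, $(-\lambda u_0)^{c_2}(x)=\inf_{y\in\Omega}\big(\frac12|x-y|^2+\lambda u_0(y)\big)$, which is Lipschitz on $\Omega$ and hence differentiable almost everywhere in the interior of $\Omega$. For almost every $x\in\Omega$, $x-\nabla(-\lambda u_0)^{c_2}(x)$ is the unique minimizer over $y\in\Omega$ of $\frac12|x-y|^2+\lambda u_0(y)$. *)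

theory Defs
  imports "HOL-Probability.Probability"
begin

definition lower_semicontinuous_on :: "'a::topological_space set \<Rightarrow> ('a \<Rightarrow> real) \<Rightarrow> bool" where
  "lower_semicontinuous_on S f \<longleftrightarrow>
     (\<forall>x\<in>S. \<forall>a<f x. \<forall>\<^sub>F y in at x within S. a < f y)"

text \<open>Measures on \<open>\<Omega>\<close> have \<open>\<Omega>\<close> itself as their space, not the whole ambient space, so that
  equality of measures is equality of their values on the Borel subsets of \<open>\<Omega>\<close>.\<close>

abbreviation borel_on :: "'a::topological_space set \<Rightarrow> 'a measure" where
  "borel_on \<Omega> \<equiv> restrict_space borel \<Omega>"

definition borel_prob_measures :: "'a::topological_space set \<Rightarrow> 'a measure set" where
  "borel_prob_measures \<Omega> = {\<rho>. prob_space \<rho> \<and> sets \<rho> = sets (borel_on \<Omega>)}"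

definition couplings :: "'a measure \<Rightarrow> 'b measure \<Rightarrow> ('a \<times> 'b) measure set" where
  "couplings \<rho> \<mu> =
     {\<gamma>. prob_space \<gamma> \<and> sets \<gamma> = sets (\<rho> \<Otimes>\<^sub>M \<mu>) \<and> distr \<gamma> \<rho> fst = \<rho> \<and> distr \<gamma> \<mu> snd = \<mu>}"

definition ennreal_sqrt :: "ennreal \<Rightarrow> ennreal" where
  "ennreal_sqrt a = (if a = \<top> then \<top> else ennreal (sqrt (enn2real a)))"

definition W2 :: "'a::euclidean_space measure \<Rightarrow> 'a measure \<Rightarrow> ennreal" where
  "W2 \<rho> \<mu> = ennreal_sqrt (INF \<gamma>\<in>couplings \<rho> \<mu>. \<integral>\<^sup>+ (x, y). ennreal ((dist x y)\<^sup>2) \<partial>\<gamma>)"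

text \<open>A lower semi-continuous function on a compact set is bounded below but need not be bounded
  above, so \<open>\<langle>u, \<rho>\<rangle>\<close> may be \<open>+\<infinity>\<close>; the Bochner integral would give \<open>0\<close> there.\<close>

definition pairing :: "('a \<Rightarrow> real) \<Rightarrow> 'a measure \<Rightarrow> ereal" where
  "pairing u \<rho> =
     enn2ereal (\<integral>\<^sup>+ x. ennreal (u x) \<partial>\<rho>) - enn2ereal (\<integral>\<^sup>+ x. ennreal (- u x) \<partial>\<rho>)"

definition objective :: "('a::euclidean_space \<Rightarrow> real) \<Rightarrow> real \<Rightarrow> 'a measure \<Rightarrow> 'a measure \<Rightarrow> ereal" where
  "objective u\<^sub>0 lam \<mu> \<rho> = ereal (1/2) * enn2ereal ((W2 \<rho> \<mu>)\<^sup>2) + ereal lam * pairing u\<^sub>0 \<rho>"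

definition c2 :: "'a::euclidean_space \<Rightarrow> 'a \<Rightarrow> real" where
  "c2 x y = (1/2) * (norm (x - y))\<^sup>2"

definition c2_transform :: "'a::euclidean_space set \<Rightarrow> ('a \<Rightarrow> real) \<Rightarrow> 'a \<Rightarrow> real" where
  "c2_transform \<Omega> f x = (INF y\<in>\<Omega>. c2 x y - f y)"

text \<open>The value at points of non-differentiability is unspecified.\<close>

definition grad :: "('a::euclidean_space \<Rightarrow> real) \<Rightarrow> 'a \<Rightarrow> 'a" where
  "grad f x = (THE D. GDERIV f x :> D)"

end

theory Submission
  imports Defs
begin

text \<open>
  Let \<open>f\<close> be \<open>lam * u\<^sub>0\<close>, shifted by a constant so that it is nonnegative, and let \<open>M\<close> be the envelope
  \<open>M x = (INF y\<in>\<Omega>. c2 x y + f y)\<close>. Integrating \<open>M x \<le> c2 x y + f y\<close> against a coupling of \<open>\<rho>\<close> and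
  \<open>\<mu>\<close> shows that the objective at \<open>\<rho>\<close> is, up to the shift, at least \<open>\<integral> M d\<mu>\<close>
  (\<open>moreau_envelope_le_transport_energy\<close>). If \<open>T x\<close> attains the infimum at almost every \<open>x\<close>, the
  coupling carried by the graph of \<open>T\<close> reaches this bound (\<open>transport_energy_distr_le\<close>), so the
  image of \<open>\<mu>\<close> under \<open>T\<close> is optimal.

  That \<open>x - grad M x\<close> is the unique minimizer for almost every \<open>x\<close> is \<open>AE_unique_minimizer\<close>. The
  function \<open>x \<bullet> x / 2 - M x\<close> is convex and has the minimizers at \<open>x\<close> among its subgradients at \<open>x\<close>,
  so the claim holds wherever this function is differentiable. Almost everywhere differentiability
  comes from \<open>AE_gderiv_of_subgradients\<close>: on each line parallel to a basis vector the subgradients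
  are monotone, so that second differences are of smaller than first order off a countable set; by
  Tonelli they are so almost everywhere, and for a convex function this implies differentiability.

  Uniqueness avoids optimal couplings, and with them any compactness of the set of couplings. If
  \<open>\<rho>\<close> is optimal and \<open>U\<close> is open, adding a small penalty \<open>e\<close> on \<open>U\<close> to \<open>f\<close> changes the energy of \<open>\<rho>\<close>
  by \<open>e\<close> times the mass of \<open>U\<close>, while the dual bound increases by at least \<open>e\<close> times the \<open>\<mu>\<close>-mass of
  \<open>{x. T x \<in> U}\<close>, to first order in \<open>e\<close>: the unique minimizer in \<open>U\<close> cannot be left cheaply. Hence
  \<open>\<rho>\<close> gives every open set at least the mass that the image of \<open>\<mu>\<close> under \<open>T\<close> does
  (\<open>minimizer_charges_open_sets\<close>), and two probability measures related in this way coincide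
  (\<open>borel_prob_measures_eqI\<close>).
\<close>

section \<open>Lower semi-continuity\<close>

lemma lower_semicontinuous_on_subset:
  assumes "lower_semicontinuous_on S f" "K \<subseteq> S"
  shows "lower_semicontinuous_on K f"
  unfolding lower_semicontinuous_on_def
proof (intro ballI allI impI)
  fix x a assume "x \<in> K" "a < f x"
  then have "\<forall>\<^sub>F y in at x within S. a < f y"
    using assms unfolding lower_semicontinuous_on_def by blast
  then show "\<forall>\<^sub>F y in at x within K. a < f y"
    using at_le[OF assms(2)] filter_leD by blast
qed

lemma lower_semicontinuous_on_superlevel:
  assumes "lower_semicontinuous_on S f"
  shows "openin (top_of_set S) {y \<in> S. a < f y}"
proof (subst openin_subopen, intro ballI)
  fix x assume x: "x \<in> {y \<in> S. a < f y}"
  then have "\<forall>\<^sub>F y in at x within S. a < f y"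
    using assms unfolding lower_semicontinuous_on_def by blast
  then obtain U where "open U" "x \<in> U" "\<And>y. y \<in> U \<Longrightarrow> y \<noteq> x \<Longrightarrow> y \<in> S \<Longrightarrow> a < f y"
    unfolding eventually_at_topological by blast
  with x show "\<exists>T. openin (top_of_set S) T \<and> x \<in> T \<and> T \<subseteq> {y \<in> S. a < f y}"
    by (intro exI[of _ "S \<inter> U"]) (auto simp: openin_open_Int)
qed

text \<open>If no point is a minimizer, every point lies in one of the open superlevel sets
  \<open>{y. f z < f y}\<close>. Finitely many of these suffice, but the lowest of the finitely many \<open>z\<close>
  lies in none of them.\<close>

lemma lower_semicontinuous_on_attains_inf:
  assumes "compact K" "K \<noteq> {}" "lower_semicontinuous_on K f"
  shows "\<exists>y\<in>K. \<forall>z\<in>K. f y \<le> f z"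
proof (rule ccontr)
  assume "\<not> ?thesis"
  then have cover: "\<exists>z\<in>K. y \<in> {y \<in> K. f z < f y}" if "y \<in> K" for y
    using that by (auto simp: not_le)
  have "\<exists>U. open U \<and> {y \<in> K. f z < f y} = K \<inter> U" for z
    using lower_semicontinuous_on_superlevel[OF assms(3), of "f z"] by (simp add: openin_open)
  then obtain U where U: "\<And>z. open (U z)" "\<And>z. {y \<in> K. f z < f y} = K \<inter> U z"
    by metis
  have "K \<subseteq> (\<Union>z\<in>K. U z)"
    using cover U(2) by blast
  then obtain Z where Z: "Z \<subseteq> K" "finite Z" "K \<subseteq> (\<Union>z\<in>Z. U z)"
    using compactE_image[OF assms(1), of K U] U(1) by metis
  have "Z \<noteq> {}"
    using Z(3) assms(2) by auto
  have "Min (f ` Z) \<in> f ` Z"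
    using Z(2) \<open>Z \<noteq> {}\<close> by (intro Min_in) auto
  then obtain z where z: "z \<in> Z" "f z = Min (f ` Z)"
    by auto
  then obtain w where "w \<in> Z" "f w < f z"
    using Z(1,3) U(2) by blast
  then show False
    using z Z(2) by (metis Min_le finite_imageI image_eqI leD)
qed

lemma lower_semicontinuous_on_add_mult:
  fixes g f :: "'a::topological_space \<Rightarrow> real"
  assumes "continuous_on S g" "lower_semicontinuous_on S f" "lam > 0"
  shows "lower_semicontinuous_on S (\<lambda>y. g y + lam * f y)"
  unfolding lower_semicontinuous_on_def
proof (intro ballI allI impI)
  fix x a assume x: "x \<in> S" and a: "a < g x + lam * f x"
  define d where "d = (g x + lam * f x - a) / 2"
  have "d > 0" using a by (simp add: d_def)
  have "f x - d / lam < f x" using \<open>d > 0\<close> assms(3) by simp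
  then have 1: "\<forall>\<^sub>F y in at x within S. f x - d / lam < f y"
    using assms(2) x unfolding lower_semicontinuous_on_def by blast
  have "(g \<longlongrightarrow> g x) (at x within S)"
    using assms(1) x by (simp add: continuous_on)
  then have 2: "\<forall>\<^sub>F y in at x within S. g x - d < g y"
    by (rule order_tendstoD) (use \<open>d > 0\<close> in simp)
  from 1 2 show "\<forall>\<^sub>F y in at x within S. a < g y + lam * f y"
  proof eventually_elim
    case (elim y)
    from elim(1) have "lam * f x - d < lam * f y"
      using assms(3) by (simp add: field_simps)
    moreover have "2 * d = g x + lam * f x - a"
      by (simp add: d_def)
    ultimately show ?case
      using elim(2) by linarith
  qed
qed

lemma lower_semicontinuous_on_borel_measurable:
  assumes "lower_semicontinuous_on S f"
  shows "f \<in> borel_measurable (borel_on S)"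
  unfolding borel_measurable_iff_greater
proof
  fix a
  obtain U where "open U" "{y \<in> S. a < f y} = S \<inter> U"
    using lower_semicontinuous_on_superlevel[OF assms, of a] by (auto simp: openin_open)
  then show "{w \<in> space (borel_on S). a < f w} \<in> sets (borel_on S)"
    by (auto simp: space_restrict_space sets_restrict_space)
qed

section \<open>Almost everywhere differentiability from subgradients\<close>

lemma convex_on_of_subgradients:
  fixes g :: "'a::real_inner \<Rightarrow> real"
  assumes "\<And>x z. g z \<ge> g x + p x \<bullet> (z - x)"
  shows "convex_on UNIV g"
proof (rule convex_onI)
  fix t :: real and x y :: 'a
  assume t: "0 < t" "t < 1"
  define w where "w = (1 - t) *\<^sub>R x + t *\<^sub>R y"
  have "(1 - t) * (g w + p w \<bullet> (x - w)) + t * (g w + p w \<bullet> (y - w)) \<le> (1 - t) * g x + t * g y"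
    using t by (intro add_mono mult_left_mono assms) auto
  moreover have "(1 - t) * (g w + p w \<bullet> (x - w)) + t * (g w + p w \<bullet> (y - w))
      = g w + p w \<bullet> ((1 - t) *\<^sub>R x + t *\<^sub>R y - w)"
    by (simp add: algebra_simps)
  ultimately show "g ((1 - t) *\<^sub>R x + t *\<^sub>R y) \<le> (1 - t) * g x + t * g y"
    by (simp add: w_def)
qed simp

text \<open>The sequence index \<open>n\<close> stands for the step length \<open>1 / (n + 1)\<close>, which avoids a zero step.
  For a convex function and fixed \<open>b\<close>, the limit in \<open>n\<close> is the jump between the two one-sided
  derivatives in direction \<open>b\<close>. It is expressed through a sequence of Borel functions of \<open>x\<close>, so the
  set where it fails to be zero is Borel, which the subgradients themselves would not show.\<close>

definition second_difference :: "('a::real_vector \<Rightarrow> real) \<Rightarrow> 'a \<Rightarrow> nat \<Rightarrow> 'a \<Rightarrow> real" where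
  "second_difference g b n x =
     real (Suc n) * (g (x + b /\<^sub>R real (Suc n)) + g (x - b /\<^sub>R real (Suc n)) - 2 * g x)"

text \<open>The remainder \<open>r v = g (x + v) - g x - p x \<bullet> v\<close> is convex and nonnegative, and along a basis
  direction it is at most a multiple of the second difference, because the linear term cancels in
  \<open>r v + r (- v)\<close>. Convexity then controls \<open>r\<close> in every direction by its values on the axes, so
  vanishing second differences along the axes already give full differentiability.\<close>

lemma gderiv_of_second_differences:
  fixes g :: "'a::euclidean_space \<Rightarrow> real"
  assumes sub: "\<And>x z. g z \<ge> g x + p x \<bullet> (z - x)"
    and lim: "\<And>b. b \<in> Basis \<Longrightarrow> (\<lambda>n. second_difference g b n x) \<longlonglongrightarrow> 0"
  shows "GDERIV g x :> p x"
proof -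
  define r where "r v = g (x + v) - g x - p x \<bullet> v" for v
  have r0: "r v \<ge> 0" for v
    using sub[of x "x + v"] by (simp add: r_def)
  have conv: "convex_on UNIV r"
  proof (rule convex_on_of_subgradients)
    show "r w \<ge> r v + (p (x + v) - p x) \<bullet> (w - v)" for v w
      using sub[of "x + v" "x + w"] by (simp add: r_def algebra_simps)
  qed
  have axis: "r (t *\<^sub>R b) \<le> \<bar>t\<bar> * second_difference g b n x" if "\<bar>t\<bar> \<le> 1 / real (Suc n)" for t b n
  proof -
    \<comment> \<open>Up to the sign of \<open>t\<close>, \<open>t *\<^sub>R b\<close> is a convex combination of \<open>0\<close> and the step of length \<open>1 / (n + 1)\<close>.\<close>
    define w where "w = (sgn t / real (Suc n)) *\<^sub>R b"
    define s where "s = \<bar>t\<bar> * real (Suc n)"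
    have s: "0 \<le> s" "s \<le> 1" using that by (auto simp: s_def field_simps)
    have tb: "t *\<^sub>R b = (1 - s) *\<^sub>R 0 + s *\<^sub>R w"
      by (simp add: s_def w_def abs_sgn[symmetric] mult_sgn_abs)
         (metis abs_sgn mult.commute sgn_mult_abs mult_sgn_abs)
    have "r (t *\<^sub>R b) \<le> (1 - s) * r 0 + s * r w"
      unfolding tb using conv s by (intro convex_onD) auto
    also have "r 0 = 0" by (simp add: r_def)
    also have "r w \<le> r (b /\<^sub>R real (Suc n)) + r (- b /\<^sub>R real (Suc n))" if "t \<noteq> 0"
      using that r0[of "b /\<^sub>R real (Suc n)"] r0[of "- b /\<^sub>R real (Suc n)"]
      by (cases "t > 0") (auto simp: w_def sgn_if divide_inverse)
    then have "s * r w \<le> s * (r (b /\<^sub>R real (Suc n)) + r (- b /\<^sub>R real (Suc n)))"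
      using s by (cases "t = 0") (auto simp: s_def intro!: mult_left_mono)
    also have "\<dots> = \<bar>t\<bar> * second_difference g b n x"
      by (simp add: s_def second_difference_def r_def)
    finally show ?thesis by simp
  qed
  have "(g has_derivative (\<lambda>v. v \<bullet> p x)) (at x)"
    unfolding has_derivative_at_alt
  proof (intro conjI allI impI)
    show "bounded_linear (\<lambda>v. v \<bullet> p x)" by (rule bounded_linear_inner_left)
    fix e :: real assume "e > 0"
    define d where "d = real DIM('a)"
    have "d > 0" by (simp add: d_def)
    have "\<forall>\<^sub>F n in sequentially. \<forall>b\<in>Basis. second_difference g b n x < e / d"
      using \<open>e > 0\<close> \<open>d > 0\<close> by (intro eventually_ball_finite ballI order_tendstoD(2)[OF lim]) auto
    then obtain n where n: "\<And>b. b \<in> Basis \<Longrightarrow> second_difference g b n x < e / d"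
      unfolding eventually_sequentially by blast
    have bound: "r v \<le> e * norm v" if v: "norm v < 1 / (d * real (Suc n))" for v
    proof -
      \<comment> \<open>\<open>v\<close> is the average of the \<open>d\<close> axis vectors obtained by scaling its components by \<open>d\<close>.\<close>
      have "r v = r (\<Sum>b\<in>Basis. (1 / d) *\<^sub>R ((d * (v \<bullet> b)) *\<^sub>R b))"
        using \<open>d > 0\<close> by (simp add: euclidean_representation)
      also have "\<dots> \<le> (\<Sum>b\<in>Basis. (1 / d) * r ((d * (v \<bullet> b)) *\<^sub>R b))"
        using \<open>d > 0\<close> by (intro convex_on_sum[OF _ _ conv]) (auto simp: d_def)
      also have "\<dots> \<le> (\<Sum>b\<in>(Basis :: 'a set). norm v * (e / d))"
      proof (rule sum_mono)
        fix b :: 'a assume b: "b \<in> Basis"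
        have vb: "\<bar>v \<bullet> b\<bar> \<le> norm v" using b by (rule Basis_le_norm)
        have "\<bar>d * (v \<bullet> b)\<bar> \<le> d * norm v"
          using \<open>d > 0\<close> vb by (simp add: abs_mult)
        also have "\<dots> \<le> 1 / real (Suc n)"
          using v \<open>d > 0\<close> by (simp add: field_simps less_imp_le del: of_nat_Suc)
        finally have "r ((d * (v \<bullet> b)) *\<^sub>R b) \<le> \<bar>d * (v \<bullet> b)\<bar> * second_difference g b n x"
          by (rule axis)
        also have "\<dots> \<le> (d * norm v) * (e / d)"
          using n[OF b] vb \<open>d > 0\<close> \<open>e > 0\<close>
          by (intro order_trans[OF mult_left_mono[OF less_imp_le] mult_right_mono])
             (auto simp: abs_mult)
        finally show "(1 / d) * r ((d * (v \<bullet> b)) *\<^sub>R b) \<le> norm v * (e / d)"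
          using \<open>d > 0\<close> by (simp add: field_simps)
      qed
      also have "\<dots> = e * norm v"
        using \<open>d > 0\<close> by (simp add: d_def)
      finally show ?thesis .
    qed
    show "\<exists>\<delta>>0. \<forall>y. norm (y - x) < \<delta> \<longrightarrow> norm (g y - g x - (y - x) \<bullet> p x) \<le> e * norm (y - x)"
    proof (intro exI[of _ "1 / (d * real (Suc n))"] conjI allI impI)
      show "0 < 1 / (d * real (Suc n))" using \<open>d > 0\<close> by simp
      fix y assume "norm (y - x) < 1 / (d * real (Suc n))"
      from bound[OF this] r0[of "y - x"]
      show "norm (g y - g x - (y - x) \<bullet> p x) \<le> e * norm (y - x)"
        by (simp add: r_def inner_commute)
    qed
  qed
  then show ?thesis by (simp add: gderiv_def)
qed

text \<open>On a line, the subgradients give a monotone function, and the second differences of \<open>g\<close> are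
  squeezed between \<open>0\<close> and the increments of that function. They can only fail to vanish at one of
  its countably many discontinuities.\<close>

lemma countable_second_difference_not_tendsto:
  fixes g :: "'a::euclidean_space \<Rightarrow> real"
  assumes sub: "\<And>x z. g z \<ge> g x + p x \<bullet> (z - x)"
  shows "countable {t. \<not> (\<lambda>n. second_difference g b n (x + t *\<^sub>R b)) \<longlonglongrightarrow> 0}"
proof -
  define q where "q t = p (x + t *\<^sub>R b) \<bullet> b" for t
  have sub': "g (x + s *\<^sub>R b) \<ge> g (x + t *\<^sub>R b) + (s - t) * q t" for s t
    using sub[of "x + t *\<^sub>R b" "x + s *\<^sub>R b"]
    by (simp add: q_def algebra_simps)
  have "mono q"
  proof
    fix s t :: real assume "s \<le> t"
    have "0 \<le> (t - s) * (q t - q s)"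
      using sub'[of s t] sub'[of t s] by (simp add: algebra_simps)
    with \<open>s \<le> t\<close> show "q s \<le> q t"
      by (cases "s = t") (auto simp: zero_le_mult_iff)
  qed
  have "(\<lambda>n. second_difference g b n (x + t *\<^sub>R b)) \<longlonglongrightarrow> 0" if t: "isCont q t" for t
  proof (rule tendsto_sandwich)
    let ?h = "\<lambda>n. inverse (real (Suc n))"
    have eq: "second_difference g b n (x + t *\<^sub>R b) = real (Suc n) *
        (g (x + (t + ?h n) *\<^sub>R b) + g (x + (t - ?h n) *\<^sub>R b) - 2 * g (x + t *\<^sub>R b))" for n
      unfolding second_difference_def by (simp add: algebra_simps)
    have "g (x + (t + ?h n) *\<^sub>R b) + g (x + (t - ?h n) *\<^sub>R b) - 2 * g (x + t *\<^sub>R b) \<ge> 0" for n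
      using sub'[of t "t + ?h n"] sub'[of t "t - ?h n"] by simp
    then show "\<forall>\<^sub>F n in sequentially. 0 \<le> second_difference g b n (x + t *\<^sub>R b)"
      unfolding eq by simp
    have le: "g (x + (t + ?h n) *\<^sub>R b) + g (x + (t - ?h n) *\<^sub>R b) - 2 * g (x + t *\<^sub>R b)
        \<le> ?h n * (q (t + ?h n) - q (t - ?h n))" for n
      using sub'[of "t + ?h n" t] sub'[of "t - ?h n" t]
      by (simp add: algebra_simps)
    have "second_difference g b n (x + t *\<^sub>R b)
        \<le> real (Suc n) * (?h n * (q (t + ?h n) - q (t - ?h n)))" for n
      unfolding eq by (rule mult_left_mono[OF le]) simp
    moreover have "real (Suc n) * (?h n * c) = c" for n c
      by (simp del: of_nat_Suc)
    ultimately have upper: "second_difference g b n (x + t *\<^sub>R b) \<le> q (t + ?h n) - q (t - ?h n)" for n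
      by metis
    show "\<forall>\<^sub>F n in sequentially. second_difference g b n (x + t *\<^sub>R b) \<le> q (t + ?h n) - q (t - ?h n)"
      by (rule always_eventually[OF allI[OF upper]])
    have "(\<lambda>n. q (t + ?h n) - q (t - ?h n)) \<longlonglongrightarrow> q t - q t"
      using tendsto_add[OF tendsto_const LIMSEQ_inverse_real_of_nat, of t]
        tendsto_diff[OF tendsto_const LIMSEQ_inverse_real_of_nat, of t]
      by (intro tendsto_diff isCont_tendsto_compose[OF t]) (simp_all del: of_nat_Suc)
    then show "(\<lambda>n. q (t + ?h n) - q (t - ?h n)) \<longlonglongrightarrow> 0" by simp
  qed simp
  then have "{t. \<not> (\<lambda>n. second_difference g b n (x + t *\<^sub>R b)) \<longlonglongrightarrow> 0} \<subseteq> {t. \<not> isCont q t}"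
    by blast
  then show ?thesis
    using mono_ctble_discont[OF \<open>mono q\<close>] countable_subset by blast
qed

text \<open>Averaging the translates of \<open>N\<close> along \<open>b\<close> over a unit of time gives back the measure of \<open>N\<close>,
  since Lebesgue measure is translation invariant; after Tonelli the inner integral over time is
  zero.\<close>

lemma null_sets_of_null_lines:
  fixes N :: "'a::euclidean_space set"
  assumes N[measurable]: "N \<in> sets borel"
    and lines: "\<And>x. countable {t::real. x + t *\<^sub>R b \<in> N}"
  shows "N \<in> null_sets lborel"
proof -
  define F where "F x t = (indicator N (x + t *\<^sub>R b) * indicator {0..1} t :: ennreal)" for x t
  have [measurable]: "case_prod F \<in> borel_measurable (lborel \<Otimes>\<^sub>M lborel)"
    unfolding F_def by measurable
  have translate: "(\<integral>\<^sup>+x. indicator N (x + c) \<partial>lborel) = emeasure lborel N" for c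
  proof -
    have "(\<integral>\<^sup>+x. indicator N (x + c) \<partial>lborel)
        = (\<integral>\<^sup>+x. indicator N x \<partial>distr lborel borel ((+) c))"
      by (subst nn_integral_distr) (auto simp: add.commute)
    then show ?thesis by (simp add: lborel_distr_plus)
  qed
  have "(\<integral>\<^sup>+t. \<integral>\<^sup>+x. F x t \<partial>lborel \<partial>lborel) = (\<integral>\<^sup>+(t::real). emeasure lborel N * indicator {0..1} t \<partial>lborel)"
    unfolding F_def by (intro nn_integral_cong) (simp add: nn_integral_multc translate)
  also have "\<dots> = emeasure lborel N"
    by (subst nn_integral_cmult) auto
  also have "(\<integral>\<^sup>+t. \<integral>\<^sup>+x. F x t \<partial>lborel \<partial>lborel) = (\<integral>\<^sup>+x. \<integral>\<^sup>+t. F x t \<partial>lborel \<partial>lborel)"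
    by (rule lborel_pair.Fubini') measurable
  also have "\<dots> = (\<integral>\<^sup>+(x::'a). 0 \<partial>lborel)"
  proof (intro nn_integral_cong)
    fix x :: 'a
    have "AE t in lborel. t \<notin> {t. x + t *\<^sub>R b \<in> N}"
      by (rule AE_not_in[OF countable_imp_null_set_lborel[OF lines]])
    then have "AE t in lborel. F x t = 0"
      by eventually_elim (simp add: F_def)
    then show "(\<integral>\<^sup>+t. F x t \<partial>lborel) = 0"
      by (subst nn_integral_cong_AE[of _ "\<lambda>_. 0"]) auto
  qed
  finally show ?thesis by (simp add: null_sets_def)
qed

text \<open>A function with a subgradient everywhere is convex, and convex functions are differentiable
  almost everywhere. Stating this for a selection \<open>p\<close> suits the application, where \<open>p x\<close> is
  a minimizer picked by choice.\<close>

proposition AE_gderiv_of_subgradients: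
  fixes g :: "'a::euclidean_space \<Rightarrow> real"
  assumes sub: "\<And>x z. g z \<ge> g x + p x \<bullet> (z - x)"
  shows "AE x in lborel. GDERIV g x :> p x"
proof -
  have "continuous_on UNIV g"
    by (intro convex_on_continuous convex_on_of_subgradients[OF sub]) simp
  then have [measurable]: "g \<in> borel_measurable borel"
    by (rule borel_measurable_continuous_onI)
  have "AE x in lborel. (\<lambda>n. second_difference g b n x) \<longlonglongrightarrow> 0" for b
  proof (rule AE_I')
    have "(\<lambda>x. second_difference g b n x) \<in> borel_measurable borel" for n
      unfolding second_difference_def by measurable
    from measurable_limit2[OF this measurable_const, of 0]
    have "{x \<in> space borel. \<not> (\<lambda>n. second_difference g b n x) \<longlonglongrightarrow> 0} \<in> sets borel"
      by measurable
    then show "{x. \<not> (\<lambda>n. second_difference g b n x) \<longlonglongrightarrow> 0} \<in> null_sets lborel"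
      by (intro null_sets_of_null_lines[where b = b])
         (simp_all add: countable_second_difference_not_tendsto[OF sub])
  qed auto
  then have "AE x in lborel. \<forall>b\<in>Basis. (\<lambda>n. second_difference g b n x) \<longlonglongrightarrow> 0"
    by (intro AE_finite_allI) auto
  then show ?thesis
    by eventually_elim (auto intro: gderiv_of_second_differences[OF sub])
qed

section \<open>The Moreau envelope and its minimizers\<close>

text \<open>This is \<open>c2_transform \<Omega> (\<lambda>y. - f y)\<close>. The sign is absorbed because \<open>f\<close> plays the role of a
  potential energy to which further terms are added.\<close>

definition moreau_envelope :: "'a::euclidean_space set \<Rightarrow> ('a \<Rightarrow> real) \<Rightarrow> 'a \<Rightarrow> real" where
  "moreau_envelope \<Omega> f x = (INF y\<in>\<Omega>. c2 x y + f y)"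

lemma c2_nonneg: "0 \<le> c2 x y"
  by (simp add: c2_def)

lemma c2_inner: "c2 x y = x \<bullet> x / 2 - x \<bullet> y + y \<bullet> y / 2"
  by (simp add: c2_def power2_norm_eq_inner inner_diff inner_commute algebra_simps)

lemma moreau_envelope_le:
  assumes "y \<in> \<Omega>" "\<And>z. z \<in> \<Omega> \<Longrightarrow> B \<le> f z"
  shows "moreau_envelope \<Omega> f x \<le> c2 x y + f y"
  unfolding moreau_envelope_def
proof (rule cINF_lower[OF _ assms(1)])
  show "bdd_below ((\<lambda>y. c2 x y + f y) ` \<Omega>)"
    using assms(2) by (intro bdd_belowI2[of _ B]) (simp add: add_increasing[OF c2_nonneg])
qed

lemma moreau_envelope_ge:
  assumes "\<Omega> \<noteq> {}" "\<And>y. y \<in> \<Omega> \<Longrightarrow> m \<le> c2 x y + f y"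
  shows "m \<le> moreau_envelope \<Omega> f x"
  unfolding moreau_envelope_def using assms by (intro cINF_greatest) auto

lemma moreau_envelope_eq:
  assumes "y \<in> \<Omega>" "\<And>z. z \<in> \<Omega> \<Longrightarrow> c2 x y + f y \<le> c2 x z + f z"
  shows "moreau_envelope \<Omega> f x = c2 x y + f y"
  unfolding moreau_envelope_def using assms by (intro cInf_eq_minimum) auto

text \<open>Up to the term \<open>x \<bullet> x / 2\<close>, the envelope is minus a supremum of affine functions of \<open>x\<close>, hence
  minus a finite convex function on the whole space. Continuity of a
  finite convex function makes the envelope continuous even when \<open>f\<close> jumps, as it does below, where
  an indicator function is added to it.\<close>

lemma continuous_moreau_envelope:
  fixes \<Omega> :: "'a::euclidean_space set"
  assumes "\<Omega> \<noteq> {}" "\<And>z. z \<in> \<Omega> \<Longrightarrow> B \<le> f z"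
  shows "continuous_on S (moreau_envelope \<Omega> f)"
proof -
  let ?M = "moreau_envelope \<Omega> f"
  define g where "g x = x \<bullet> x / 2 - ?M x" for x
  have affine: "x \<bullet> z - z \<bullet> z / 2 - f z \<le> g x" if "z \<in> \<Omega>" for x z
    using moreau_envelope_le[where f = f and x = x, OF that assms(2)] by (simp add: g_def c2_inner)
  have "convex_on UNIV g"
  proof (rule convex_onI)
    fix t :: real and x y :: 'a
    assume t: "0 < t" "t < 1"
    define w where "w = (1 - t) *\<^sub>R x + t *\<^sub>R y"
    have "w \<bullet> w / 2 - ((1 - t) * g x + t * g y) \<le> ?M w"
    proof (rule moreau_envelope_ge[OF assms(1)])
      fix z assume "z \<in> \<Omega>"
      have "(1 - t) * (x \<bullet> z - z \<bullet> z / 2 - f z) + t * (y \<bullet> z - z \<bullet> z / 2 - f z)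
          \<le> (1 - t) * g x + t * g y"
        using t by (intro add_mono mult_left_mono affine \<open>z \<in> \<Omega>\<close>) auto
      moreover have "(1 - t) * (x \<bullet> z - z \<bullet> z / 2 - f z) + t * (y \<bullet> z - z \<bullet> z / 2 - f z)
          = w \<bullet> z - z \<bullet> z / 2 - f z"
        unfolding w_def by (simp add: inner_add_left) (simp add: algebra_simps diff_divide_distrib)
      ultimately show "w \<bullet> w / 2 - ((1 - t) * g x + t * g y) \<le> c2 w z + f z"
        by (simp add: c2_inner)
    qed
    then show "g ((1 - t) *\<^sub>R x + t *\<^sub>R y) \<le> (1 - t) * g x + t * g y"
      by (simp add: g_def[of w] flip: w_def)
  qed simp
  then have "continuous_on UNIV g"
    by (intro convex_on_continuous) auto
  then have "continuous_on UNIV (\<lambda>x. x \<bullet> x / 2 - g x)"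
    by (intro continuous_intros) auto
  then show ?thesis
    by (simp add: g_def continuous_on_subset[of UNIV])
qed

lemma moreau_envelope_subgradient:
  assumes "y \<in> \<Omega>" "\<And>z. z \<in> \<Omega> \<Longrightarrow> c2 x y + f y \<le> c2 x z + f z"
    and "\<And>z. z \<in> \<Omega> \<Longrightarrow> B \<le> f z"
  shows "z \<bullet> z / 2 - moreau_envelope \<Omega> f z \<ge> x \<bullet> x / 2 - moreau_envelope \<Omega> f x + y \<bullet> (z - x)"
  using moreau_envelope_le[where f = f and x = z, OF assms(1,3)] moreau_envelope_eq[of y \<Omega> x f] assms(1,2)
  by (simp add: c2_inner inner_diff inner_commute)

lemma gderiv_eq_subgradient:
  fixes g :: "'a::real_inner \<Rightarrow> real"
  assumes "GDERIV g x :> D" "\<And>z. g z \<ge> g x + y \<bullet> (z - x)"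
  shows "D = y"
proof -
  have "((\<lambda>z. g z - z \<bullet> y) has_derivative (\<lambda>h. h \<bullet> D - h \<bullet> y)) (at x)"
    using assms(1) unfolding gderiv_def by (intro derivative_intros)
  moreover have "g x - x \<bullet> y \<le> g z - z \<bullet> y" for z
    using assms(2)[of z] by (simp add: inner_diff_right inner_commute)
  ultimately have "(\<lambda>h. h \<bullet> D - h \<bullet> y) = (\<lambda>h. 0)"
    by (intro differential_zero_maxmin[of x UNIV]) auto
  then have "(D - y) \<bullet> D - (D - y) \<bullet> y = 0"
    by meson
  then show ?thesis
    by (simp flip: inner_diff_right)
qed

lemma grad_eqI:
  assumes "GDERIV f x :> D"
  shows "grad f x = D"
  unfolding grad_def
proof (rule the_equality[where P = "\<lambda>D. GDERIV f x :> D", OF assms])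
  fix E assume "GDERIV f x :> E"
  with assms have "(\<lambda>h. h \<bullet> D) = (\<lambda>h. h \<bullet> E)"
    unfolding gderiv_def by (rule has_derivative_unique)
  then have "(E - D) \<bullet> D = (E - D) \<bullet> E"
    by meson
  then have "(E - D) \<bullet> (E - D) = 0"
    by (simp add: inner_diff_right)
  then show "E = D"
    by simp
qed

text \<open>Every minimizer at \<open>x\<close> is a subgradient at \<open>x\<close> of the convex function
  \<open>x \<bullet> x / 2 - moreau_envelope \<Omega> f x\<close>. Where this function is differentiable there is only one
  subgradient, hence only one minimizer, and it is \<open>x\<close> minus the gradient of the envelope.\<close>

proposition AE_unique_minimizer:
  fixes \<Omega> :: "'a::euclidean_space set"
  assumes "compact \<Omega>" "\<Omega> \<noteq> {}" "lower_semicontinuous_on \<Omega> f"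
  shows "AE x in lborel. let y = x - grad (moreau_envelope \<Omega> f) x in
           y \<in> \<Omega> \<and> (\<forall>z\<in>\<Omega>. z \<noteq> y \<longrightarrow> c2 x y + f y < c2 x z + f z)"
proof -
  let ?M = "moreau_envelope \<Omega> f"
  have "lower_semicontinuous_on \<Omega> (\<lambda>y. c2 x y + 1 * f y)" for x
    unfolding c2_def
    by (intro lower_semicontinuous_on_add_mult assms(3) continuous_intros) simp
  then have "\<exists>y\<in>\<Omega>. \<forall>z\<in>\<Omega>. c2 x y + f y \<le> c2 x z + f z" for x
    by (intro lower_semicontinuous_on_attains_inf assms) simp
  then obtain p where p: "\<And>x. p x \<in> \<Omega>" "\<And>x z. z \<in> \<Omega> \<Longrightarrow> c2 x (p x) + f (p x) \<le> c2 x z + f z"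
    by metis
  obtain B where B: "\<And>z. z \<in> \<Omega> \<Longrightarrow> B \<le> f z"
    using lower_semicontinuous_on_attains_inf[OF assms] by blast
  define g where "g x = x \<bullet> x / 2 - ?M x" for x
  have sub: "g z \<ge> g x + y \<bullet> (z - x)"
    if "y \<in> \<Omega>" "\<And>z. z \<in> \<Omega> \<Longrightarrow> c2 x y + f y \<le> c2 x z + f z" for x y z
    unfolding g_def using that B by (rule moreau_envelope_subgradient)
  have "AE x in lborel. GDERIV g x :> p x"
    by (rule AE_gderiv_of_subgradients) (rule sub[OF p])
  then show ?thesis
  proof eventually_elim
    case (elim x)
    have "((\<lambda>x. x \<bullet> x / 2 - g x) has_derivative (\<lambda>h. h \<bullet> (x - p x))) (at x)"
      using elim unfolding gderiv_def
      by (auto intro!: derivative_eq_intros simp: inner_diff_right inner_commute)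
    then have "GDERIV ?M x :> x - p x"
      by (simp add: gderiv_def g_def)
    then have "grad ?M x = x - p x"
      by (rule grad_eqI)
    moreover have "c2 x (p x) + f (p x) < c2 x z + f z" if "z \<in> \<Omega>" "z \<noteq> p x" for z
    proof (rule ccontr)
      assume "\<not> ?thesis"
      with p(2)[of _ x] have "\<And>w. w \<in> \<Omega> \<Longrightarrow> c2 x z + f z \<le> c2 x w + f w"
        by (meson leI order_trans)
      from gderiv_eq_subgradient[OF elim sub[OF that(1) this]] that(2)
      show False by simp
    qed
    ultimately show ?case
      using p(1) by (simp add: Let_def)
  qed
qed

section \<open>Duality between the transport energy and the envelope\<close>

lemma borel_prob_measuresD:
  assumes "\<rho> \<in> borel_prob_measures \<Omega>"
  shows "prob_space \<rho>" "sets \<rho> = sets (borel_on \<Omega>)" "space \<rho> = \<Omega>"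
    and "measurable \<rho> N = measurable (borel_on \<Omega>) N"
proof -
  show *: "prob_space \<rho>" "sets \<rho> = sets (borel_on \<Omega>)"
    using assms by (auto simp: borel_prob_measures_def)
  show "space \<rho> = \<Omega>"
    using sets_eq_imp_space_eq[OF *(2)] by (simp add: space_restrict_space)
  show "measurable \<rho> N = measurable (borel_on \<Omega>) N"
    using *(2) by (rule measurable_cong_sets) simp
qed

lemma power2_ennreal_sqrt: "(ennreal_sqrt a)\<^sup>2 = a"
  by (cases a) (auto simp: ennreal_sqrt_def ennreal_power)

lemma W2_power2:
  "(W2 \<rho> \<mu>)\<^sup>2 = (INF \<gamma>\<in>couplings \<rho> \<mu>. \<integral>\<^sup>+ (x, y). ennreal ((dist x y)\<^sup>2) \<partial>\<gamma>)"
  by (simp add: W2_def power2_ennreal_sqrt)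

lemma ennreal_c2: "ennreal (c2 x y) = ennreal (1/2) * ennreal ((dist x y)\<^sup>2)"
  by (subst ennreal_mult[symmetric]) (auto simp: c2_def dist_norm)

text \<open>This replaces the choice of an optimal coupling: a lower bound valid for each coupling passes to
  the infimum.\<close>

lemma le_INF_affine_ennreal:
  fixes L c :: ennreal and X :: "'i \<Rightarrow> ennreal"
  assumes "a > 0" "\<And>i. i \<in> I \<Longrightarrow> L \<le> ennreal a * X i + c"
  shows "L \<le> ennreal a * (INF i\<in>I. X i) + c"
proof (cases "c = \<top>")
  case False
  have inv: "ennreal a * (ennreal (1 / a) * t) = t" "ennreal (1 / a) * (ennreal a * t) = t" for t
    using \<open>a > 0\<close> by (simp_all add: mult.assoc[symmetric] ennreal_mult[symmetric])
  have "ennreal (1 / a) * (L - c) \<le> X i" if "i \<in> I" for i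
  proof -
    have "L - c \<le> ennreal a * X i"
      using assms(2)[OF that] False by (simp add: ennreal_minus_le_iff add.commute)
    from mult_left_mono[OF this, of "ennreal (1 / a)"] show ?thesis
      by (simp add: inv)
  qed
  then have "ennreal (1 / a) * (L - c) \<le> (INF i\<in>I. X i)"
    by (rule INF_greatest)
  from mult_left_mono[OF this, of "ennreal a"] have "L - c \<le> ennreal a * (INF i\<in>I. X i)"
    by (simp add: inv)
  with False show ?thesis
    by (simp add: ennreal_minus_le_iff add.commute)
qed simp

definition transport_energy :: "('a::euclidean_space \<Rightarrow> real) \<Rightarrow> 'a measure \<Rightarrow> 'a measure \<Rightarrow> ennreal" where
  "transport_energy f \<mu> \<rho> = ennreal (1/2) * (W2 \<rho> \<mu>)\<^sup>2 + (\<integral>\<^sup>+ y. ennreal (f y) \<partial>\<rho>)"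

lemma measurable_dist_coupling:
  fixes \<Omega> :: "'a::euclidean_space set"
  assumes "sets \<rho> = sets (borel_on \<Omega>)" "sets \<mu> = sets (borel_on \<Omega>)" "sets \<gamma> = sets (\<rho> \<Otimes>\<^sub>M \<mu>)"
  shows "(\<lambda>p. (dist (fst p) (snd p))\<^sup>2) \<in> borel_measurable \<gamma>"
proof -
  have id: "(\<lambda>x. x) \<in> borel_on \<Omega> \<rightarrow>\<^sub>M (borel :: 'a measure)"
    by (rule measurable_restrict_space1) simp
  then have [measurable]: "(\<lambda>x. x) \<in> \<rho> \<rightarrow>\<^sub>M (borel :: 'a measure)" "(\<lambda>x. x) \<in> \<mu> \<rightarrow>\<^sub>M (borel :: 'a measure)"
    by (simp_all add: measurable_cong_sets[OF assms(1) refl] measurable_cong_sets[OF assms(2) refl])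
  have "(\<lambda>p. (dist (fst p) (snd p))\<^sup>2) \<in> borel_measurable (\<rho> \<Otimes>\<^sub>M \<mu>)"
    using measurable_compose[OF measurable_fst \<open>(\<lambda>x. x) \<in> \<rho> \<rightarrow>\<^sub>M borel\<close>, of \<mu>]
      measurable_compose[OF measurable_snd \<open>(\<lambda>x. x) \<in> \<mu> \<rightarrow>\<^sub>M borel\<close>, of \<rho>]
    by measurable
  then show ?thesis
    by (simp add: measurable_cong_sets[OF assms(3) refl])
qed

text \<open>For every coupling the pointwise bound \<open>moreau_envelope \<Omega> f x \<le> c2 x y + f y\<close> integrates to this
  weak duality inequality.\<close>

lemma moreau_envelope_le_transport_energy:
  fixes \<Omega> :: "'a::euclidean_space set"
  assumes \<mu>: "\<mu> \<in> borel_prob_measures \<Omega>" and \<rho>: "\<rho> \<in> borel_prob_measures \<Omega>"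
    and f: "f \<in> borel_measurable (borel_on \<Omega>)" "\<And>y. y \<in> \<Omega> \<Longrightarrow> 0 \<le> f y"
  shows "(\<integral>\<^sup>+ x. ennreal (moreau_envelope \<Omega> f x) \<partial>\<mu>) \<le> transport_energy f \<mu> \<rho>"
  unfolding transport_energy_def W2_power2
proof (rule le_INF_affine_ennreal)
  fix \<gamma> assume "\<gamma> \<in> couplings \<rho> \<mu>"
  then have \<gamma>: "sets \<gamma> = sets (\<rho> \<Otimes>\<^sub>M \<mu>)" "distr \<gamma> \<rho> fst = \<rho>" "distr \<gamma> \<mu> snd = \<mu>"
    by (auto simp: couplings_def)
  note \<mu>D = borel_prob_measuresD[OF \<mu>] and \<rho>D = borel_prob_measuresD[OF \<rho>]
  have space: "space \<gamma> = \<Omega> \<times> \<Omega>"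
    using sets_eq_imp_space_eq[OF \<gamma>(1)] by (simp add: space_pair_measure \<mu>D \<rho>D)
  have [measurable]: "fst \<in> \<gamma> \<rightarrow>\<^sub>M \<rho>" "snd \<in> \<gamma> \<rightarrow>\<^sub>M \<mu>"
    by (simp_all add: measurable_cong_sets[OF \<gamma>(1) refl])
  have ne: "\<Omega> \<noteq> {}"
    using prob_space.not_empty[OF \<mu>D(1)] by (simp add: \<mu>D)
  have [measurable]: "moreau_envelope \<Omega> f \<in> borel_measurable \<mu>"
    unfolding \<mu>D(4)
    by (intro measurable_restrict_space1 borel_measurable_continuous_onI
        continuous_moreau_envelope[OF ne f(2)])
  have [measurable]: "f \<in> borel_measurable \<rho>"
    using f(1) by (simp add: \<rho>D(4))
  have [measurable]: "(\<lambda>p. (dist (fst p) (snd p))\<^sup>2) \<in> borel_measurable \<gamma>"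
    by (rule measurable_dist_coupling[OF \<rho>D(2) \<mu>D(2) \<gamma>(1)])
  have "(\<integral>\<^sup>+ x. ennreal (moreau_envelope \<Omega> f x) \<partial>\<mu>)
      = (\<integral>\<^sup>+ x. ennreal (moreau_envelope \<Omega> f x) \<partial>distr \<gamma> \<mu> snd)"
    by (simp add: \<gamma>)
  also have "\<dots> = (\<integral>\<^sup>+ p. ennreal (moreau_envelope \<Omega> f (snd p)) \<partial>\<gamma>)"
    by (rule nn_integral_distr) measurable
  also have "\<dots> \<le> (\<integral>\<^sup>+ p. ennreal (1/2) * ennreal ((dist (fst p) (snd p))\<^sup>2) + ennreal (f (fst p)) \<partial>\<gamma>)"
  proof (rule nn_integral_mono)
    fix p assume "p \<in> space \<gamma>"
    then have p: "fst p \<in> \<Omega>" "snd p \<in> \<Omega>" by (auto simp: space)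
    have "ennreal (moreau_envelope \<Omega> f (snd p)) \<le> ennreal (c2 (snd p) (fst p) + f (fst p))"
      by (rule ennreal_leI[OF moreau_envelope_le[OF p(1) f(2)]])
    then show "ennreal (moreau_envelope \<Omega> f (snd p))
        \<le> ennreal (1/2) * ennreal ((dist (fst p) (snd p))\<^sup>2) + ennreal (f (fst p))"
      by (simp add: c2_nonneg f(2)[OF p(1)] ennreal_c2 dist_commute)
  qed
  also have "\<dots> = ennreal (1/2) * (\<integral>\<^sup>+ p. ennreal ((dist (fst p) (snd p))\<^sup>2) \<partial>\<gamma>)
      + (\<integral>\<^sup>+ p. ennreal (f (fst p)) \<partial>\<gamma>)"
    by (subst nn_integral_add) (auto simp: nn_integral_cmult)
  also have "(\<integral>\<^sup>+ p. ennreal (f (fst p)) \<partial>\<gamma>) = (\<integral>\<^sup>+ y. ennreal (f y) \<partial>distr \<gamma> \<rho> fst)"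
    by (rule nn_integral_distr[symmetric]) measurable
  finally show "(\<integral>\<^sup>+ x. ennreal (moreau_envelope \<Omega> f x) \<partial>\<mu>)
      \<le> ennreal (1/2) * (\<integral>\<^sup>+ (x, y). ennreal ((dist x y)\<^sup>2) \<partial>\<gamma>) + (\<integral>\<^sup>+ y. ennreal (f y) \<partial>\<rho>)"
    by (simp only: \<gamma> case_prod_beta')
qed simp

lemma distr_in_borel_prob_measures:
  assumes "\<mu> \<in> borel_prob_measures \<Omega>" "T \<in> borel_on \<Omega> \<rightarrow>\<^sub>M borel_on \<Omega>"
  shows "distr \<mu> (borel_on \<Omega>) T \<in> borel_prob_measures \<Omega>"
  using assms prob_space.prob_space_distr[of \<mu> T "borel_on \<Omega>"]
  by (simp add: borel_prob_measures_def borel_prob_measuresD(4)[OF assms(1)])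

text \<open>The coupling concentrated on the graph of \<open>T\<close> turns the pointwise duality inequality into an
  equality.\<close>

lemma transport_energy_distr_le:
  fixes \<Omega> :: "'a::euclidean_space set"
  assumes \<mu>: "\<mu> \<in> borel_prob_measures \<Omega>" and T: "T \<in> borel_on \<Omega> \<rightarrow>\<^sub>M borel_on \<Omega>"
    and f: "f \<in> borel_measurable (borel_on \<Omega>)" "\<And>y. y \<in> \<Omega> \<Longrightarrow> 0 \<le> f y"
    and opt: "AE x in \<mu>. c2 x (T x) + f (T x) = moreau_envelope \<Omega> f x"
  shows "transport_energy f \<mu> (distr \<mu> (borel_on \<Omega>) T)
           \<le> (\<integral>\<^sup>+ x. ennreal (moreau_envelope \<Omega> f x) \<partial>\<mu>)"
proof -
  define \<rho> where "\<rho> = distr \<mu> (borel_on \<Omega>) T"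
  define \<gamma> where "\<gamma> = distr \<mu> (\<rho> \<Otimes>\<^sub>M \<mu>) (\<lambda>x. (T x, x))"
  note \<mu>D = borel_prob_measuresD[OF \<mu>]
  have \<rho>D: "sets \<rho> = sets (borel_on \<Omega>)" by (simp add: \<rho>_def)
  have T\<mu>[measurable]: "T \<in> \<mu> \<rightarrow>\<^sub>M borel_on \<Omega>"
    using T by (simp add: \<mu>D(4))
  then have [measurable]: "T \<in> \<mu> \<rightarrow>\<^sub>M \<rho>"
    by (simp add: measurable_cong_sets[OF refl \<rho>D])
  have dist_meas: "(\<lambda>p. (dist (fst p) (snd p))\<^sup>2) \<in> borel_measurable (\<rho> \<Otimes>\<^sub>M \<mu>)"
    by (rule measurable_dist_coupling[OF \<rho>D \<mu>D(2) refl])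
  have [measurable]: "(\<lambda>x. (dist (T x) x)\<^sup>2) \<in> borel_measurable \<mu>"
    using measurable_compose[OF _ dist_meas, of "\<lambda>x. (T x, x)" \<mu>] by simp
  have "distr \<gamma> \<rho> fst = \<rho>"
    unfolding \<gamma>_def by (subst distr_distr) (auto simp: comp_def \<rho>_def intro!: distr_cong)
  moreover have "distr \<gamma> \<mu> snd = \<mu>"
    unfolding \<gamma>_def by (subst distr_distr) (auto simp: comp_def intro!: distr_id)
  moreover have "prob_space \<gamma>"
    unfolding \<gamma>_def by (rule prob_space.prob_space_distr[OF \<mu>D(1)]) measurable
  ultimately have "\<gamma> \<in> couplings \<rho> \<mu>"
    by (simp add: couplings_def \<gamma>_def)
  then have "(W2 \<rho> \<mu>)\<^sup>2 \<le> (\<integral>\<^sup>+ (x, y). ennreal ((dist x y)\<^sup>2) \<partial>\<gamma>)"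
    unfolding W2_power2 by (rule INF_lower)
  also have "\<dots> = (\<integral>\<^sup>+ x. ennreal ((dist (T x) x)\<^sup>2) \<partial>\<mu>)"
    unfolding \<gamma>_def using dist_meas by (subst nn_integral_distr) (auto simp: case_prod_beta)
  finally have "transport_energy f \<mu> \<rho>
      \<le> ennreal (1/2) * (\<integral>\<^sup>+ x. ennreal ((dist (T x) x)\<^sup>2) \<partial>\<mu>) + (\<integral>\<^sup>+ y. ennreal (f y) \<partial>\<rho>)"
    unfolding transport_energy_def by (intro add_right_mono mult_left_mono) auto
  also have "(\<integral>\<^sup>+ y. ennreal (f y) \<partial>\<rho>) = (\<integral>\<^sup>+ x. ennreal (f (T x)) \<partial>\<mu>)"
    unfolding \<rho>_def using f(1) by (intro nn_integral_distr T\<mu>) auto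
  also have "ennreal (1/2) * (\<integral>\<^sup>+ x. ennreal ((dist (T x) x)\<^sup>2) \<partial>\<mu>) + (\<integral>\<^sup>+ x. ennreal (f (T x)) \<partial>\<mu>)
      = (\<integral>\<^sup>+ x. ennreal (1/2) * ennreal ((dist (T x) x)\<^sup>2) + ennreal (f (T x)) \<partial>\<mu>)"
    using measurable_compose[OF T\<mu> f(1)]
    by (subst nn_integral_add) (auto simp: nn_integral_cmult)
  also have "\<dots> = (\<integral>\<^sup>+ x. ennreal (moreau_envelope \<Omega> f x) \<partial>\<mu>)"
  proof (rule nn_integral_cong_AE)
    from opt AE_space show "AE x in \<mu>. ennreal (1/2) * ennreal ((dist (T x) x)\<^sup>2) + ennreal (f (T x))
        = ennreal (moreau_envelope \<Omega> f x)"
    proof eventually_elim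
      case (elim x)
      have "T x \<in> \<Omega>"
        using measurable_space[OF T\<mu> elim(2)] by (simp add: space_restrict_space)
      with f(2) have "0 \<le> f (T x)" by blast
      then show ?case
        by (simp add: elim(1)[symmetric] c2_nonneg ennreal_c2 dist_commute)
    qed
  qed
  finally show ?thesis
    by (simp add: \<rho>_def)
qed

text \<open>Shifting \<open>u\<close> by a constant makes it nonnegative, so that the objective, up to that constant, takes
  values in the extended nonnegative reals, where integrals are additive without integrability conditions.
  The value \<open>\<infinity>\<close> is kept, for measures on which \<open>u\<close> is not integrable.\<close>

lemma objective_eq_transport_energy:
  fixes \<Omega> :: "'a::euclidean_space set"
  assumes \<rho>: "\<rho> \<in> borel_prob_measures \<Omega>" and u: "u \<in> borel_measurable (borel_on \<Omega>)"
    and K: "0 \<le> K" "\<And>y. y \<in> \<Omega> \<Longrightarrow> - K \<le> u y" and "0 < lam"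
  shows "objective u lam \<mu> \<rho>
    = enn2ereal (transport_energy (\<lambda>y. lam * (u y + K)) \<mu> \<rho>) - ereal (lam * K)"
proof -
  note \<rho>D = borel_prob_measuresD[OF \<rho>]
  interpret prob_space \<rho> by (rule \<rho>D)
  have [measurable]: "u \<in> borel_measurable \<rho>" using u by (simp add: \<rho>D(4))
  define P where "P = (\<integral>\<^sup>+ y. ennreal (u y) \<partial>\<rho>)"
  define N where "N = (\<integral>\<^sup>+ y. ennreal (- u y) \<partial>\<rho>)"
  define A where "A = (\<integral>\<^sup>+ y. ennreal (u y + K) \<partial>\<rho>)"
  have "A + N = (\<integral>\<^sup>+ y. ennreal (u y + K) + ennreal (- u y) \<partial>\<rho>)"
    unfolding A_def N_def by (rule nn_integral_add[symmetric]) measurable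
  also have "\<dots> = (\<integral>\<^sup>+ y. ennreal (u y) + ennreal K \<partial>\<rho>)"
  proof (rule nn_integral_cong)
    fix y assume "y \<in> space \<rho>"
    then have "- K \<le> u y" using K(2) by (simp add: \<rho>D)
    then show "ennreal (u y + K) + ennreal (- u y) = ennreal (u y) + ennreal K"
      using K(1) by (cases "u y \<ge> 0") (auto simp: ennreal_neg simp flip: ennreal_plus)
  qed
  also have "\<dots> = P + ennreal K"
    unfolding P_def by (subst nn_integral_add) (auto simp: emeasure_space_1)
  finally have AN: "A + N = P + ennreal K" .
  have "N \<le> (\<integral>\<^sup>+ y. ennreal K \<partial>\<rho>)"
    unfolding N_def using K(2) by (intro nn_integral_mono ennreal_leI) (auto simp: \<rho>D minus_le_iff)
  then have "N \<le> ennreal K" by (simp add: emeasure_space_1)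
  then obtain n where n: "0 \<le> n" "N = ennreal n"
    by (cases N) (auto simp: top_unique)
  have pairing: "pairing u \<rho> = enn2ereal A - ereal K"
  proof (cases A)
    case (real a)
    have "P \<noteq> \<top>"
    proof
      assume "P = \<top>"
      with AN n real show False by (simp flip: ennreal_plus)
    qed
    then obtain p where p: "0 \<le> p" "P = ennreal p"
      by (cases P) auto
    have "a + n = p + K"
      using AN n real p K(1) by (simp flip: ennreal_plus)
    then show ?thesis
      unfolding pairing_def P_def[symmetric] N_def[symmetric] using n real p
      by (simp add: algebra_simps)
  next
    case top
    then have "P + ennreal K = \<top>" using AN by simp
    then have "P = \<top>" by (simp add: ennreal_add_eq_top)
    then show ?thesis
      unfolding pairing_def P_def[symmetric] N_def[symmetric] using n top by simp
  qed
  have "(\<integral>\<^sup>+ y. ennreal (lam * (u y + K)) \<partial>\<rho>) = (\<integral>\<^sup>+ y. ennreal lam * ennreal (u y + K) \<partial>\<rho>)"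
    using \<open>0 < lam\<close> by (intro nn_integral_cong ennreal_mult') simp
  also have "\<dots> = ennreal lam * A"
    unfolding A_def by (rule nn_integral_cmult) measurable
  finally have "transport_energy (\<lambda>y. lam * (u y + K)) \<mu> \<rho> = ennreal (1/2) * (W2 \<rho> \<mu>)\<^sup>2 + ennreal lam * A"
    by (simp add: transport_energy_def)
  moreover have "enn2ereal (ennreal (1/2)) = ereal (1/2)" "enn2ereal (ennreal lam) = ereal lam"
    using \<open>0 < lam\<close> by (simp_all only: enn2ereal_ennreal less_imp_le zero_le_divide_1_iff zero_le_numeral)
  ultimately have energy: "enn2ereal (transport_energy (\<lambda>y. lam * (u y + K)) \<mu> \<rho>)
      = ereal (1/2) * enn2ereal ((W2 \<rho> \<mu>)\<^sup>2) + ereal lam * enn2ereal A"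
    by (simp only: plus_ennreal.rep_eq times_ennreal.rep_eq)
  have "ereal lam * (enn2ereal A - ereal K) = ereal lam * enn2ereal A - ereal (lam * K)"
    using \<open>0 < lam\<close> by (cases "enn2ereal A") (auto simp: algebra_simps)
  then show ?thesis
    by (simp only: objective_def pairing energy add_diff_eq_ereal)
qed

section \<open>Uniqueness by perturbing the potential\<close>

text \<open>Outside \<open>U\<close> the cost has a minimum which exceeds the value at the unique minimizer \<open>y\<close> by
  some \<open>d > 0\<close>. As long as the penalty paid on \<open>U\<close> is at most \<open>d\<close>, it cannot be evaded by leaving
  \<open>U\<close>, so the envelope rises by the whole penalty.\<close>

lemma moreau_envelope_perturbed:
  fixes \<Omega> U :: "'a::euclidean_space set"
  assumes \<Omega>: "compact \<Omega>" and f: "lower_semicontinuous_on \<Omega> f"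
    and U: "open U" "y \<in> U"
    and y: "y \<in> \<Omega>" "\<And>z. z \<in> \<Omega> \<Longrightarrow> z \<noteq> y \<Longrightarrow> c2 x y + f y < c2 x z + f z"
  shows "\<exists>d>0. \<forall>e. 0 \<le> e \<and> e \<le> d \<longrightarrow>
    moreau_envelope \<Omega> f x + e \<le> moreau_envelope \<Omega> (\<lambda>z. f z + e * indicator U z) x"
proof -
  have min: "c2 x y + f y \<le> c2 x z + f z" if "z \<in> \<Omega>" for z
    using y(2)[OF that] by (cases "z = y") auto
  have M: "moreau_envelope \<Omega> f x = c2 x y + f y"
    by (rule moreau_envelope_eq[OF y(1) min])
  have "\<exists>d>0. \<forall>z\<in>\<Omega> - U. c2 x y + f y + d \<le> c2 x z + f z"
  proof (cases "\<Omega> - U = {}")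
    case True
    then show ?thesis by (intro exI[of _ 1]) auto
  next
    case False
    have "lower_semicontinuous_on \<Omega> (\<lambda>z. c2 x z + 1 * f z)"
      unfolding c2_def by (intro lower_semicontinuous_on_add_mult f continuous_intros) simp
    then have "lower_semicontinuous_on (\<Omega> - U) (\<lambda>z. c2 x z + f z)"
      by (auto intro: lower_semicontinuous_on_subset)
    then obtain w where w: "w \<in> \<Omega> - U" "\<And>z. z \<in> \<Omega> - U \<Longrightarrow> c2 x w + f w \<le> c2 x z + f z"
      using lower_semicontinuous_on_attains_inf[OF compact_diff[OF \<Omega> U(1)] False] by blast
    have "c2 x y + f y < c2 x w + f w"
      using w(1) U(2) by (intro y(2)) auto
    then show ?thesis
      using w(2) by (intro exI[of _ "c2 x w + f w - (c2 x y + f y)"]) auto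
  qed
  then obtain d where d: "d > 0" "\<And>z. z \<in> \<Omega> - U \<Longrightarrow> c2 x y + f y + d \<le> c2 x z + f z"
    by blast
  have "c2 x y + f y + e \<le> c2 x z + (f z + e * indicator U z)" if "z \<in> \<Omega>" "e \<le> d" for e z
    using d(2)[of z] min[of z] that by (cases "z \<in> U") auto
  then have "moreau_envelope \<Omega> f x + e \<le> moreau_envelope \<Omega> (\<lambda>z. f z + e * indicator U z) x"
    if "e \<le> d" for e
    using that y(1) unfolding M by (intro moreau_envelope_ge) auto
  with d(1) show ?thesis by blast
qed

text \<open>Weak duality for \<open>f + e * indicator U\<close>, compared with equality for \<open>f\<close>, bounds the integral of the
  difference quotient of the envelopes in \<open>e\<close> by the mass which \<open>\<rho>\<close> gives to \<open>U\<close>. As \<open>e\<close> tends to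
  zero the quotient is eventually at least \<open>1\<close> wherever \<open>T x\<close> lies in \<open>U\<close>, and Fatou's lemma gives the
  claim.\<close>

lemma minimizer_charges_open_sets:
  fixes \<Omega> U :: "'a::euclidean_space set"
  assumes \<Omega>: "compact \<Omega>" and f: "lower_semicontinuous_on \<Omega> f" "\<And>y. y \<in> \<Omega> \<Longrightarrow> 0 \<le> f y"
    and \<mu>: "\<mu> \<in> borel_prob_measures \<Omega>" and \<rho>: "\<rho> \<in> borel_prob_measures \<Omega>"
    and T: "T \<in> borel_on \<Omega> \<rightarrow>\<^sub>M borel_on \<Omega>"
    and opt: "AE x in \<mu>. \<forall>z\<in>\<Omega>. z \<noteq> T x \<longrightarrow> c2 x (T x) + f (T x) < c2 x z + f z"
    and min: "transport_energy f \<mu> \<rho> \<le> (\<integral>\<^sup>+ x. ennreal (moreau_envelope \<Omega> f x) \<partial>\<mu>)"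
    and U: "open U"
  shows "emeasure (distr \<mu> (borel_on \<Omega>) T) (\<Omega> \<inter> U) \<le> emeasure \<rho> (\<Omega> \<inter> U)"
proof -
  note \<mu>D = borel_prob_measuresD[OF \<mu>] and \<rho>D = borel_prob_measuresD[OF \<rho>]
  have ne: "\<Omega> \<noteq> {}"
    using prob_space.not_empty[OF \<mu>D(1)] by (simp add: \<mu>D)
  have fm: "f \<in> borel_measurable (borel_on \<Omega>)"
    by (rule lower_semicontinuous_on_borel_measurable[OF f(1)])
  have T\<mu>[measurable]: "T \<in> \<mu> \<rightarrow>\<^sub>M borel_on \<Omega>"
    using T by (simp add: \<mu>D(4))
  define e where "e n = 1 / real (Suc n)" for n
  have e: "e n > 0" for n by (simp add: e_def)
  define h where "h n z = f z + e n * indicator U z" for n z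
  have h0: "0 \<le> h n y" if "y \<in> \<Omega>" for n y
    using f(2)[OF that] e[of n] by (simp add: h_def)
  define M where "M = moreau_envelope \<Omega> f"
  define D where "D n x = moreau_envelope \<Omega> (h n) x - M x" for n x
  have M0: "0 \<le> M x" for x
    unfolding M_def by (rule moreau_envelope_ge[OF ne]) (simp add: c2_nonneg f(2))
  have D0: "0 \<le> D n x" for n x
  proof -
    have "M x \<le> moreau_envelope \<Omega> (h n) x"
    proof (rule moreau_envelope_ge[OF ne])
      fix y assume y: "y \<in> \<Omega>"
      have "M x \<le> c2 x y + f y"
        unfolding M_def by (rule moreau_envelope_le[OF y f(2)])
      then show "M x \<le> c2 x y + h n y"
        using e[of n] by (simp add: h_def indicator_def)
    qed
    then show ?thesis by (simp add: D_def)
  qed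
  have cont: "continuous_on S M" "continuous_on S (moreau_envelope \<Omega> (h n))" for S n
    unfolding M_def using continuous_moreau_envelope[OF ne f(2)] continuous_moreau_envelope[OF ne h0]
    by auto
  have [measurable]: "M \<in> borel_measurable \<mu>" "D n \<in> borel_measurable \<mu>" for n
    unfolding \<mu>D(4) D_def[abs_def]
    by (intro measurable_restrict_space1 borel_measurable_continuous_onI continuous_intros cont)+
  define L where "L = (\<integral>\<^sup>+ x. ennreal (M x) \<partial>\<mu>)"
  \<comment> \<open>Finiteness is what allows \<open>L\<close> to be cancelled from both sides of the duality inequality.\<close>
  have "L \<noteq> \<top>"
  proof -
    obtain x0 where x0: "\<And>x. x \<in> \<Omega> \<Longrightarrow> M x \<le> M x0"
      using continuous_attains_sup[OF \<Omega> ne cont(1)] by blast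
    have "L \<le> (\<integral>\<^sup>+ x. ennreal (M x0) \<partial>\<mu>)"
      unfolding L_def by (intro nn_integral_mono ennreal_leI x0) (simp add: \<mu>D)
    also have "\<dots> = ennreal (M x0)"
      using prob_space.emeasure_space_1[OF \<mu>D(1)] by simp
    finally show ?thesis
      by (metis ennreal_less_top leD top.not_eq_extremum)
  qed
  have bound: "(\<integral>\<^sup>+ x. ennreal (real (Suc n) * D n x) \<partial>\<mu>) \<le> emeasure \<rho> (\<Omega> \<inter> U)" for n
  proof -
    have [measurable]: "indicator U \<in> borel_measurable (borel_on \<Omega>)"
      using U by (intro measurable_restrict_space1 borel_measurable_indicator) auto
    have hm: "h n \<in> borel_measurable (borel_on \<Omega>)"
      unfolding h_def[abs_def] using fm by measurable
    have "(\<integral>\<^sup>+ y. ennreal (h n y) \<partial>\<rho>)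
        = (\<integral>\<^sup>+ y. ennreal (f y) + ennreal (e n) * indicator (\<Omega> \<inter> U) y \<partial>\<rho>)"
    proof (rule nn_integral_cong)
      fix y assume "y \<in> space \<rho>"
      then have "y \<in> \<Omega>" by (simp add: \<rho>D)
      then show "ennreal (h n y) = ennreal (f y) + ennreal (e n) * indicator (\<Omega> \<inter> U) y"
        using f(2)[of y] e[of n] by (simp add: h_def indicator_def)
    qed
    also have "\<dots> = (\<integral>\<^sup>+ y. ennreal (f y) \<partial>\<rho>) + ennreal (e n) * emeasure \<rho> (\<Omega> \<inter> U)"
    proof -
      have "\<Omega> \<inter> U \<in> sets \<rho>"
        using U by (auto simp: \<rho>D(2) sets_restrict_space)
      moreover have "f \<in> borel_measurable \<rho>"
        using fm by (simp add: \<rho>D(4))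
      ultimately show ?thesis
        by (subst nn_integral_add) (auto simp: nn_integral_cmult)
    qed
    finally have energy: "transport_energy (h n) \<mu> \<rho>
        = transport_energy f \<mu> \<rho> + ennreal (e n) * emeasure \<rho> (\<Omega> \<inter> U)"
      by (simp only: transport_energy_def add.assoc)
    have "L + (\<integral>\<^sup>+ x. ennreal (D n x) \<partial>\<mu>) = (\<integral>\<^sup>+ x. ennreal (M x) + ennreal (D n x) \<partial>\<mu>)"
      unfolding L_def by (rule nn_integral_add[symmetric]) measurable
    also have "\<dots> = (\<integral>\<^sup>+ x. ennreal (moreau_envelope \<Omega> (h n) x) \<partial>\<mu>)"
    proof (rule nn_integral_cong)
      fix x
      have "moreau_envelope \<Omega> (h n) x = M x + D n x" by (simp add: D_def)
      then show "ennreal (M x) + ennreal (D n x) = ennreal (moreau_envelope \<Omega> (h n) x)"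
        by (simp only: ennreal_plus[OF M0 D0])
    qed
    also have "\<dots> \<le> transport_energy (h n) \<mu> \<rho>"
      by (rule moreau_envelope_le_transport_energy[OF \<mu> \<rho> hm h0])
    also have "\<dots> \<le> L + ennreal (e n) * emeasure \<rho> (\<Omega> \<inter> U)"
      unfolding energy using min by (intro add_right_mono) (simp add: L_def M_def)
    finally have "(\<integral>\<^sup>+ x. ennreal (D n x) \<partial>\<mu>) \<le> ennreal (e n) * emeasure \<rho> (\<Omega> \<inter> U)"
      using \<open>L \<noteq> \<top>\<close> by (simp add: ennreal_add_left_cancel_le)
    then have "ennreal (real (Suc n)) * (\<integral>\<^sup>+ x. ennreal (D n x) \<partial>\<mu>)
        \<le> ennreal (real (Suc n)) * (ennreal (e n) * emeasure \<rho> (\<Omega> \<inter> U))"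
      by (rule mult_left_mono) simp
    also have "\<dots> = emeasure \<rho> (\<Omega> \<inter> U)"
      by (simp add: e_def mult.assoc[symmetric] ennreal_mult[symmetric] del: of_nat_Suc)
    also have "ennreal (real (Suc n)) * (\<integral>\<^sup>+ x. ennreal (D n x) \<partial>\<mu>)
        = (\<integral>\<^sup>+ x. ennreal (real (Suc n) * D n x) \<partial>\<mu>)"
      by (subst nn_integral_cmult[symmetric]) (auto simp: ennreal_mult D0 simp del: of_nat_Suc)
    finally show ?thesis .
  qed
  have [measurable]: "\<Omega> \<inter> U \<in> sets (borel_on \<Omega>)"
    using U by (auto simp: sets_restrict_space)
  have "emeasure (distr \<mu> (borel_on \<Omega>) T) (\<Omega> \<inter> U)
      = (\<integral>\<^sup>+ y. indicator (\<Omega> \<inter> U) y \<partial>distr \<mu> (borel_on \<Omega>) T)"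
    by (rule nn_integral_indicator[symmetric]) simp
  also have "\<dots> = (\<integral>\<^sup>+ x. indicator (\<Omega> \<inter> U) (T x) \<partial>\<mu>)"
    by (rule nn_integral_distr[OF T\<mu>]) measurable
  also have "\<dots> \<le> (\<integral>\<^sup>+ x. liminf (\<lambda>n. ennreal (real (Suc n) * D n x)) \<partial>\<mu>)"
  proof (rule nn_integral_mono_AE)
    from opt AE_space show "AE x in \<mu>. indicator (\<Omega> \<inter> U) (T x)
        \<le> liminf (\<lambda>n. ennreal (real (Suc n) * D n x))"
    proof eventually_elim
      case (elim x)
      show ?case
      proof (cases "T x \<in> \<Omega> \<inter> U")
        case True
        with elim(1) obtain d where d: "d > 0" "\<And>e. 0 \<le> e \<Longrightarrow> e \<le> d \<Longrightarrow>
            M x + e \<le> moreau_envelope \<Omega> (\<lambda>z. f z + e * indicator U z) x"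
          using moreau_envelope_perturbed[OF \<Omega> f(1) U, of "T x" x] unfolding M_def by blast
        have "\<forall>\<^sub>F n in sequentially. e n < d"
          unfolding e_def using d(1) LIMSEQ_inverse_real_of_nat
          by (intro order_tendstoD) (auto simp: inverse_eq_divide simp del: of_nat_Suc)
        then have "\<forall>\<^sub>F n in sequentially. 1 \<le> ennreal (real (Suc n) * D n x)"
        proof eventually_elim
          case (elim n)
          have "e n \<le> D n x"
            using d(2)[of "e n"] elim e[of n] by (simp add: D_def h_def[abs_def])
          then have "real (Suc n) * e n \<le> real (Suc n) * D n x"
            by (intro mult_left_mono) auto
          then show ?case
            by (simp add: e_def del: of_nat_Suc)
        qed
        then have "1 \<le> liminf (\<lambda>n. ennreal (real (Suc n) * D n x))"
          by (rule Liminf_bounded)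
        with True show ?thesis by simp
      qed simp
    qed
  qed
  also have "\<dots> \<le> liminf (\<lambda>n. \<integral>\<^sup>+ x. ennreal (real (Suc n) * D n x) \<partial>\<mu>)"
    by (rule nn_integral_liminf) measurable
  also have "\<dots> \<le> emeasure \<rho> (\<Omega> \<inter> U)"
    by (intro Liminf_le always_eventually allI bound) simp
  finally show ?thesis .
qed

text \<open>Outer regularity extends the inequality from open sets to all Borel sets, and passing to
  complements turns it into an equality because both total masses are one. Both measures
  are first extended by zero to the whole space.\<close>

lemma borel_prob_measures_eqI:
  fixes \<Omega> :: "'a::euclidean_space set"
  assumes \<Omega>: "\<Omega> \<in> sets borel"
    and \<rho>: "\<rho> \<in> borel_prob_measures \<Omega>" and \<nu>: "\<nu> \<in> borel_prob_measures \<Omega>"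
    and le: "\<And>U. open U \<Longrightarrow> emeasure \<nu> (\<Omega> \<inter> U) \<le> emeasure \<rho> (\<Omega> \<inter> U)"
  shows "\<rho> = \<nu>"
proof -
  have id: "(\<lambda>x. x) \<in> \<sigma> \<rightarrow>\<^sub>M (borel :: 'a measure)" if "\<sigma> \<in> borel_prob_measures \<Omega>" for \<sigma>
    unfolding borel_prob_measuresD(4)[OF that] by (rule measurable_restrict_space1) simp
  define ext where "ext \<sigma> = distr \<sigma> (borel :: 'a measure) (\<lambda>x. x)" for \<sigma> :: "'a measure"
  have ext: "prob_space (ext \<sigma>)" "sets (ext \<sigma>) = sets borel"
    "\<And>A. A \<in> sets borel \<Longrightarrow> emeasure (ext \<sigma>) A = emeasure \<sigma> (\<Omega> \<inter> A)"
    if "\<sigma> \<in> borel_prob_measures \<Omega>" for \<sigma>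
    using prob_space.prob_space_distr[OF borel_prob_measuresD(1)[OF that] id[OF that]] id[OF that]
    by (auto simp: ext_def emeasure_distr borel_prob_measuresD(3)[OF that] Int_commute)
  have ext_le: "emeasure (ext \<nu>) A \<le> emeasure (ext \<rho>) A" if A: "A \<in> sets borel" for A
  proof -
    interpret R: prob_space "ext \<rho>" by (rule ext[OF \<rho>])
    interpret N: prob_space "ext \<nu>" by (rule ext[OF \<nu>])
    have "emeasure (ext \<nu>) A = (INF U\<in>{U. A \<subseteq> U \<and> open U}. emeasure (ext \<nu>) U)"
      using A by (intro outer_regular) (simp_all add: ext[OF \<nu>])
    also have "\<dots> \<le> (INF U\<in>{U. A \<subseteq> U \<and> open U}. emeasure (ext \<rho>) U)"
      using le ext(3)[OF \<rho>] ext(3)[OF \<nu>] by (intro INF_mono) (metis borel_open mem_Collect_eq)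
    also have "\<dots> = emeasure (ext \<rho>) A"
      using A by (intro outer_regular[symmetric]) (simp_all add: ext[OF \<rho>])
    finally show ?thesis .
  qed
  show ?thesis
  proof (rule measure_eqI)
    show sets: "sets \<rho> = sets \<nu>"
      by (simp add: borel_prob_measuresD(2)[OF \<rho>] borel_prob_measuresD(2)[OF \<nu>])
    fix A assume A: "A \<in> sets \<rho>"
    interpret R: prob_space \<rho> by (rule borel_prob_measuresD[OF \<rho>])
    interpret N: prob_space \<nu> by (rule borel_prob_measuresD[OF \<nu>])
    have le: "emeasure \<nu> B \<le> emeasure \<rho> B" if "B \<in> sets \<rho>" for B
    proof -
      have "B \<in> sets borel" "\<Omega> \<inter> B = B"
        using that \<Omega> by (auto simp: borel_prob_measuresD(2)[OF \<rho>] sets_restrict_space)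
      with ext_le[of B] show ?thesis
        by (simp add: ext(3)[OF \<rho>] ext(3)[OF \<nu>])
    qed
    have "measure \<nu> A \<le> measure \<rho> A" "measure \<nu> (space \<rho> - A) \<le> measure \<rho> (space \<rho> - A)"
      using le[OF A] le[OF sets.compl_sets[OF A]]
      by (simp_all add: R.emeasure_eq_measure N.emeasure_eq_measure)
    then have "measure \<nu> A = measure \<rho> A"
      using A sets_eq_imp_space_eq[OF sets] R.prob_compl[OF A] N.prob_compl[of A] by (simp add: sets)
    then show "emeasure \<rho> A = emeasure \<nu> A"
      by (simp add: R.emeasure_eq_measure N.emeasure_eq_measure)
  qed
qed

section \<open>The minimizer of the proximal transport problem\<close>

theorem lemma3p3:
  fixes \<Omega> :: "'a::euclidean_space set"
    and u\<^sub>0 :: "'a \<Rightarrow> real" and lam :: real and \<mu> :: "'a measure" and T :: "'a \<Rightarrow> 'a"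
  assumes "compact \<Omega>"
    and "frontier \<Omega> \<in> null_sets lborel"
    and "lower_semicontinuous_on \<Omega> u\<^sub>0"
    and "lam > 0"
    and "\<mu> \<in> borel_prob_measures \<Omega>"
    and "absolutely_continuous (restrict_space lborel \<Omega>) \<mu>"
    and "T \<in> borel_on \<Omega> \<rightarrow>\<^sub>M borel_on \<Omega>"
    and "AE x in \<mu>. T x = x - grad (c2_transform \<Omega> (\<lambda>y. - lam * u\<^sub>0 y)) x"
  shows "{\<rho>. is_arg_min (objective u\<^sub>0 lam \<mu>) (\<lambda>\<rho>. \<rho> \<in> borel_prob_measures \<Omega>) \<rho>}
           = {distr \<mu> (borel_on \<Omega>) T}"
proof -
  note \<mu> = assms(5) and T = assms(7) and lam = assms(4)
  have \<Omega>: "\<Omega> \<in> sets borel"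
    using assms(1) by (simp add: compact_imp_closed)
  have ne: "\<Omega> \<noteq> {}"
    using prob_space.not_empty[OF borel_prob_measuresD(1)[OF \<mu>]] borel_prob_measuresD(3)[OF \<mu>] by simp
  obtain y0 where y0: "\<And>y. y \<in> \<Omega> \<Longrightarrow> u\<^sub>0 y0 \<le> u\<^sub>0 y"
    using lower_semicontinuous_on_attains_inf[OF assms(1) ne assms(3)] by blast
  \<comment> \<open>A lower semi-continuous function on a compact set is bounded below; \<open>K\<close> shifts it to be nonnegative.\<close>
  define K where "K = \<bar>u\<^sub>0 y0\<bar>"
  have K: "0 \<le> K" "\<And>y. y \<in> \<Omega> \<Longrightarrow> - K \<le> u\<^sub>0 y"
    using y0 by (force simp: K_def)+
  define f where "f y = lam * (u\<^sub>0 y + K)" for y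
  have f0: "0 \<le> f y" if "y \<in> \<Omega>" for y
    using K(2)[OF that] lam by (simp add: f_def)
  have f_eq: "f y = lam * K + lam * u\<^sub>0 y" for y
    by (simp add: f_def algebra_simps)
  have f_lsc: "lower_semicontinuous_on \<Omega> f"
    unfolding f_eq[abs_def] by (intro lower_semicontinuous_on_add_mult assms(3) lam continuous_intros)
  have lsc: "lower_semicontinuous_on \<Omega> (\<lambda>y. 0 + lam * u\<^sub>0 y)"
    by (intro lower_semicontinuous_on_add_mult assms(3) lam continuous_intros)
  have fm: "f \<in> borel_measurable (borel_on \<Omega>)" and um: "u\<^sub>0 \<in> borel_measurable (borel_on \<Omega>)"
    using lower_semicontinuous_on_borel_measurable f_lsc assms(3) by auto
  have "AE x in lborel. let y = x - grad (moreau_envelope \<Omega> (\<lambda>y. lam * u\<^sub>0 y)) x in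
      y \<in> \<Omega> \<and> (\<forall>z\<in>\<Omega>. z \<noteq> y \<longrightarrow> c2 x y + lam * u\<^sub>0 y < c2 x z + lam * u\<^sub>0 z)"
    using AE_unique_minimizer[OF assms(1) ne lsc] by simp
  then have "AE x in restrict_space lborel \<Omega>. let y = x - grad (moreau_envelope \<Omega> (\<lambda>y. lam * u\<^sub>0 y)) x in
      y \<in> \<Omega> \<and> (\<forall>z\<in>\<Omega>. z \<noteq> y \<longrightarrow> c2 x y + lam * u\<^sub>0 y < c2 x z + lam * u\<^sub>0 z)"
    using \<Omega> by (subst AE_restrict_space_iff) auto
  then have "AE x in \<mu>. let y = x - grad (moreau_envelope \<Omega> (\<lambda>y. lam * u\<^sub>0 y)) x in
      y \<in> \<Omega> \<and> (\<forall>z\<in>\<Omega>. z \<noteq> y \<longrightarrow> c2 x y + lam * u\<^sub>0 y < c2 x z + lam * u\<^sub>0 z)"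
    using borel_prob_measuresD(2)[OF \<mu>]
    by (intro absolutely_continuous_AE[OF _ assms(6)]) (simp_all add: sets_restrict_space)
  with assms(8) have "AE x in \<mu>. T x \<in> \<Omega> \<and>
      (\<forall>z\<in>\<Omega>. z \<noteq> T x \<longrightarrow> c2 x (T x) + f (T x) < c2 x z + f z)"
    by eventually_elim (simp add: moreau_envelope_def[abs_def] c2_transform_def[abs_def] Let_def f_eq)
  then have T_in: "AE x in \<mu>. T x \<in> \<Omega>"
    and opt: "AE x in \<mu>. \<forall>z\<in>\<Omega>. z \<noteq> T x \<longrightarrow> c2 x (T x) + f (T x) < c2 x z + f z"
    by auto
  then have attained: "AE x in \<mu>. c2 x (T x) + f (T x) = moreau_envelope \<Omega> f x"
    by eventually_elim (metis moreau_envelope_eq less_imp_le order_refl)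
  define \<nu> where "\<nu> = distr \<mu> (borel_on \<Omega>) T"
  have \<nu>: "\<nu> \<in> borel_prob_measures \<Omega>"
    unfolding \<nu>_def by (rule distr_in_borel_prob_measures[OF \<mu> T])
  define L where "L = (\<integral>\<^sup>+ x. ennreal (moreau_envelope \<Omega> f x) \<partial>\<mu>)"
  have lower: "L \<le> transport_energy f \<mu> \<rho>" if "\<rho> \<in> borel_prob_measures \<Omega>" for \<rho>
    unfolding L_def by (rule moreau_envelope_le_transport_energy[OF \<mu> that fm f0])
  have upper: "transport_energy f \<mu> \<nu> \<le> L"
    unfolding L_def \<nu>_def by (rule transport_energy_distr_le[OF \<mu> T fm f0 attained])
  have obj: "objective u\<^sub>0 lam \<mu> \<rho> = enn2ereal (transport_energy f \<mu> \<rho>) - ereal (lam * K)"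
    if "\<rho> \<in> borel_prob_measures \<Omega>" for \<rho>
    unfolding f_def[abs_def] by (rule objective_eq_transport_energy[OF that um K lam])
  have obj_less: "objective u\<^sub>0 lam \<mu> \<rho> < objective u\<^sub>0 lam \<mu> \<sigma> \<longleftrightarrow>
      transport_energy f \<mu> \<rho> < transport_energy f \<mu> \<sigma>"
    if "\<rho> \<in> borel_prob_measures \<Omega>" "\<sigma> \<in> borel_prob_measures \<Omega>" for \<rho> \<sigma>
    unfolding obj[OF that(1)] obj[OF that(2)] less_ennreal.rep_eq
    by (cases "enn2ereal (transport_energy f \<mu> \<rho>)"; cases "enn2ereal (transport_energy f \<mu> \<sigma>)") auto
  have "is_arg_min (objective u\<^sub>0 lam \<mu>) (\<lambda>\<rho>. \<rho> \<in> borel_prob_measures \<Omega>) \<nu>"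
    unfolding is_arg_min_def
    using \<nu> obj_less[OF _ \<nu>] order_trans[OF upper lower] by (auto simp flip: not_le)
  moreover have "\<rho> = \<nu>"
    if "is_arg_min (objective u\<^sub>0 lam \<mu>) (\<lambda>\<rho>. \<rho> \<in> borel_prob_measures \<Omega>) \<rho>" for \<rho>
  proof -
    have \<rho>: "\<rho> \<in> borel_prob_measures \<Omega>" and "\<not> objective u\<^sub>0 lam \<mu> \<nu> < objective u\<^sub>0 lam \<mu> \<rho>"
      using that \<nu> by (auto simp: is_arg_min_def)
    then have energy: "transport_energy f \<mu> \<rho> \<le> L"
      using obj_less[OF \<nu>] upper by (auto simp: not_less intro: order_trans)
    have "emeasure \<nu> (\<Omega> \<inter> U) \<le> emeasure \<rho> (\<Omega> \<inter> U)" if "open U" for U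
      unfolding \<nu>_def
      by (rule minimizer_charges_open_sets[OF assms(1) f_lsc f0 \<mu> \<rho> T opt energy[unfolded L_def] that])
    then show ?thesis
      by (rule borel_prob_measures_eqI[OF \<Omega> \<rho> \<nu>])
  qed
  ultimately show ?thesis
    unfolding \<nu>_def by blast
qed

end
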